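(* Let $n>1$ be an integer, let $p\in\{1,\ldots,n\}$, and let $k\in\mathbb{R}$ with $k<0$ and $-k\geq n-p+1$. Then for all positive real numbers $x_1,\ldots,x_n$, $$\sum_{i=1}^{n}\left(\frac{x_i}{x_{i+1}}\right)^k\geq \sum_{i=1}^{n}\frac{x_i}{x_{i+p-1}}.$$
   Context: Indices of the variables are understood cyclically modulo $n$, i.e. $x_{j+n}=x_j$ for every integer $j$. *)

theory Defs
  imports Complex_Main
begin

end

theory Submission
  imports Defs "HOL-Analysis.Convex"
begin

text \<open>
  Put \<open>q = -k\<close>, \<open>m = n - p + 1\<close> and \<open>b\<^sub>j = ln (x\<^sub>j\<^sub>+\<^sub>1 / x\<^sub>j)\<close>, so that the \<open>b\<^sub>j\<close> sum to zero over a
  period. The left-hand side is the sum of the \<open>exp (q b\<^sub>j)\<close>, and \<open>x\<^sub>i / x\<^sub>i\<^sub>+\<^sub>p\<^sub>-\<^sub>1\<close> is the exponential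
  of the sum of \<open>m\<close> consecutive \<open>b\<^sub>j\<close>. Because the total sum vanishes, that exponent is also the convex
  combination of the \<open>q b\<^sub>j\<close> which gives extra weight \<open>1/q\<close> to the window and spreads the remaining
  \<open>1 - m/q \<ge> 0\<close> uniformly. Apply Jensen's inequality to \<open>exp\<close> and sum over all windows.
\<close>

lemma sum_periodic_shift:
  fixes f :: "int \<Rightarrow> 'a::ab_group_add"
  assumes "\<And>j. f (j + int n) = f j"
  shows "(\<Sum>i=1..int n. f (i + int s)) = (\<Sum>i=1..int n. f i)"
proof (induction s)
  case (Suc s)
  \<comment> \<open>Stated for arbitrary \<open>g\<close> and a fresh \<open>n\<close>, since
    induction on the length would break periodicity; for periodic summands the two boundary terms
    cancel.\<close>
  have shift: "(\<Sum>i=1..int n. g (i + 1)) = (\<Sum>i=1..int n. g i) + g (1 + int n) - g 1"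
    for g :: "int \<Rightarrow> 'a" and n :: nat
  proof (induction n)
    case (Suc n)
    have "{1..int (Suc n)} = insert (1 + int n) {1..int n}"
      by auto
    with Suc show ?case
      by (simp add: algebra_simps)
  qed simp
  have "(\<Sum>i=1..int n. f (i + int (Suc s))) = (\<Sum>i=1..int n. f ((i + 1) + int s))"
    by (simp add: algebra_simps)
  also have "\<dots> = (\<Sum>i=1..int n. f (i + int s))"
    using shift[of "\<lambda>i. f (i + int s)" n] assms[of "1 + int s"] by (simp add: algebra_simps)
  finally show ?case
    using Suc by simp
qed simp

lemma exp_weighted_sum_le:
  fixes w y :: "'a \<Rightarrow> real"
  assumes "finite S" "\<And>i. i \<in> S \<Longrightarrow> w i \<ge> 0" "(\<Sum>i\<in>S. w i) = 1"
  shows "exp (\<Sum>i\<in>S. w i * y i) \<le> (\<Sum>i\<in>S. w i * exp (y i))"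
proof -
  have "S \<noteq> {}"
    using assms(3) by auto
  then show ?thesis
    using convex_on_sum[OF assms(1) _ exp_convex, of w y] assms by simp
qed

text \<open>This is the inequality in logarithmic form, \<open>L\<close> standing for
  \<open>ln x\<close>. The offset \<open>s\<close> is taken to be \<open>p - 1\<close>, where the
  windows for the quotients start.\<close>

lemma sum_exp_windows_le:
  fixes L :: "int \<Rightarrow> real" and q :: real
  assumes n: "n > 0" and mn: "m \<le> n" and q: "q > 0" "real m \<le> q"
    and cyclic: "\<And>j. L (j + int n) = L j"
  shows "(\<Sum>i=1..int n. exp (L (i + int s + int m) - L (i + int s)))
       \<le> (\<Sum>i=1..int n. exp (q * (L (i + 1) - L i)))"
proof -
  define b where "b j = L (j + 1) - L j" for j
  define w where "w t = (if t < m then 1 / q else 0) + (1 - real m / q) / real n" for t :: nat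
  have split: "(\<Sum>t<n. w t * g t)
      = (\<Sum>t<m. g t) / q + (1 - real m / q) / real n * (\<Sum>t<n. g t)" for g
  proof -
    have "(\<Sum>t<n. (if t < m then 1 / q else 0) * g t) = (\<Sum>t<m. g t / q)"
      using mn by (intro sum.mono_neutral_cong_right) auto
    then show ?thesis
      by (simp add: w_def distrib_right sum.distrib sum_distrib_left sum_divide_distrib)
  qed
  have w_nonneg: "w t \<ge> 0" for t
    using q by (auto simp: w_def)
  have w_sum: "(\<Sum>t<n. w t) = 1"
    using split[of "\<lambda>_. 1"] n by simp
  have telescope: "(\<Sum>t<l. b (j + int t)) = L (j + int l) - L j" for j l
    by (induction l) (simp_all add: b_def algebra_simps)
  have jensen: "exp (L (j + int m) - L j) \<le> (\<Sum>t<n. w t * exp (q * b (j + int t)))" for j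
  proof -
    \<comment> \<open>The uniform part of the weights contributes a multiple of
      \<open>L (j + int n) - L j = 0\<close>; in the window part \<open>q\<close> cancels
      \<open>1 / q\<close> and the sum telescopes.\<close>
    have "(\<Sum>t<n. w t * (q * b (j + int t))) = L (j + int m) - L j"
      using q by (simp add: split telescope cyclic flip: sum_distrib_left)
    then show ?thesis
      using exp_weighted_sum_le[of "{..<n}" w "\<lambda>t. q * b (j + int t)"] w_nonneg w_sum by simp
  qed
  have periodic: "exp (q * b (j + int n)) = exp (q * b j)" for j
    using cyclic[of "j + 1"] cyclic[of j] by (simp add: b_def algebra_simps)
  have "(\<Sum>i=1..int n. exp (L (i + int s + int m) - L (i + int s)))
      \<le> (\<Sum>i=1..int n. \<Sum>t<n. w t * exp (q * b (i + int s + int t)))"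
    by (intro sum_mono jensen)
  \<comment> \<open>After the swap each inner sum runs over a full period shifted by
    \<open>s + t\<close>, so it does not depend on \<open>t\<close> and the weights add up to
    1.\<close>
  also have "\<dots> = (\<Sum>t<n. w t * (\<Sum>i=1..int n. exp (q * b (i + int (s + t)))))"
    by (subst sum.swap) (simp add: sum_distrib_left add.assoc)
  also have "\<dots> = (\<Sum>i=1..int n. exp (q * b i))"
    using sum_periodic_shift[of "\<lambda>j. exp (q * b j)", OF periodic] w_sum
    by (simp del: of_nat_add flip: sum_distrib_right)
  finally show ?thesis
    by (simp add: b_def)
qed

theorem corollary2p4:
  fixes n p :: nat and k :: real and x :: "int \<Rightarrow> real"
  assumes "n > 1"
    and "p \<in> {1..n}"
    and "k < 0"
    and "- k \<ge> real n - real p + 1"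
    and cyclic: "\<And>j. x (j + int n) = x j"
    and pos: "\<And>i. i \<in> {1..int n} \<Longrightarrow> x i > 0"
  shows "(\<Sum>i=1..int n. (x i / x (i + 1)) powr k) \<ge> (\<Sum>i=1..int n. x i / x (i + int p - 1))"
proof -
  define L where "L j = ln (x j)" for j
  \<comment> \<open>Positivity is given on one period only, but the indices \<open>i + 1\<close> and
    \<open>i + int p - 1\<close> can exceed \<open>n\<close>.\<close>
  have pos_shift: "x (1 + int t) > 0" for t
  proof (induction t rule: less_induct)
    case (less t)
    show ?case
    proof (cases "t < n")
      case True
      then show ?thesis
        by (intro pos) auto
    next
      case False
      then have "x (1 + int t) = x (1 + int (t - n))"
        using cyclic[of "1 + int (t - n)"] by (simp add: of_nat_diff algebra_simps)
      then show ?thesis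
        using less[of "t - n"] False assms(1) by simp
    qed
  qed
  have pos': "x j > 0" if "j \<ge> 1" for j
    using pos_shift[of "nat (j - 1)"] that by simp
  have powr_eq: "(x i / x (i + 1)) powr k = exp (- k * (L (i + 1) - L i))" if "i \<in> {1..int n}" for i
    using pos'[of i] pos'[of "i + 1"] that
    by (simp add: powr_def ln_div L_def algebra_simps)
  \<comment> \<open>The window starts at the denominator's index and ends at
    \<open>i + int n\<close>, where periodicity returns the numerator \<open>x i\<close>.\<close>
  have quot_eq: "x i / x (i + int p - 1)
      = exp (L (i + int (p - 1) + int (n - p + 1)) - L (i + int (p - 1)))"
    if "i \<in> {1..int n}" for i
  proof -
    have "i + int (p - 1) + int (n - p + 1) = i + int n" and p1: "i + int (p - 1) = i + int p - 1"
      using assms(2) by auto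
    then have "L (i + int (p - 1) + int (n - p + 1)) = L i"
      using cyclic by (simp add: L_def)
    then show ?thesis
      using pos'[of i] pos'[of "i + int p - 1"] that assms(2) unfolding p1 by (simp add: L_def exp_diff)
  qed
  have "(\<Sum>i=1..int n. exp (L (i + int (p - 1) + int (n - p + 1)) - L (i + int (p - 1))))
      \<le> (\<Sum>i=1..int n. exp (- k * (L (i + 1) - L i)))"
    using assms by (intro sum_exp_windows_le) (auto simp: L_def of_nat_diff)
  then show ?thesis
    by (simp only: sum.cong[OF refl powr_eq] sum.cong[OF refl quot_eq])
qed

end
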